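(* Let $\boldsymbol{p}=\prod_{k=1}^K[\underline p_k,\overline p_k]\subset\mathbb{R}^K$ be a box with $\underline p_k\le\overline p_k$, let $A^{(0)},\dots,A^{(K)}\in\mathbb{R}^{n\times n}$, let $A(p)=A^{(0)}+\sum_{k=1}^K A^{(k)}p_k$, and suppose that the parametric interval matrix $A(\boldsymbol{p})$ is symmetric, i.e. $A(p)$ is a symmetric matrix for every $p\in\boldsymbol{p}$. Then the following assertions are equivalent: (i) $A(\boldsymbol{p})$ is Schur stable; (ii) $A(p)$ is Schur stable for each $p\in\mathbb{R}^K$ such that $p_k\in\{\underline p_k,\overline p_k\}$ for all $k=1,\dots,K$.
   Context: A parametric interval matrix with affine-linear dependencies is a family $A(\boldsymbol{p})=\{A(p)=A^{(0)}+\sum_{k=1}^K A^{(k)}p_k \mid p\in\boldsymbol{p}\}$ of real $n\times n$ matrices, where $\boldsymbol{p}$ is a product of compact intervals. A real square matrix is Schur stable if $|\lambda|<1$ for each of its eigenvalues $\lambda$. $A(\boldsymbol{p})$ is Schur stable if $A(p)$ is Schur stable for each $p\in\boldsymbol{p}$. *)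

theory Defs
  imports Complex_Main "HOL-Library.FuncSet" "Jordan_Normal_Form.Char_Poly"
begin

text \<open>
  The eigenvalues of a real matrix are its complex eigenvalues, so the entries are
  embedded into the complex numbers first.
\<close>
definition schur_stable :: "real mat \<Rightarrow> bool" where
  "schur_stable M \<longleftrightarrow>
     (\<forall>\<mu>. eigenvalue (map_mat complex_of_real M) \<mu> \<longrightarrow> cmod \<mu> < 1)"

definition symmetric_matrix :: "'a mat \<Rightarrow> bool" where
  "symmetric_matrix M \<longleftrightarrow> transpose_mat M = M"

text \<open>
  Points of \<open>\<real>\<^sup>K\<close> are extensional functions on \<open>{1..K}\<close>. The affine combination
  \<open>A 0 + (\<Sum>k = 1..K. p k \<cdot>\<^sub>m A k)\<close> is written entrywise because matrices of
  varying dimension do not form a type with a zero, as \<open>sum\<close> would require.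
\<close>
definition param_mat :: "nat \<Rightarrow> nat \<Rightarrow> (nat \<Rightarrow> real mat) \<Rightarrow> (nat \<Rightarrow> real) \<Rightarrow> real mat" where
  "param_mat n K A p =
     mat n n (\<lambda>(i, j). A 0 $$ (i, j) + (\<Sum>k = 1..K. A k $$ (i, j) * p k))"

definition param_box :: "nat \<Rightarrow> (nat \<Rightarrow> real) \<Rightarrow> (nat \<Rightarrow> real) \<Rightarrow> (nat \<Rightarrow> real) set" where
  "param_box K lo hi = (\<Pi>\<^sub>E k\<in>{1..K}. {lo k..hi k})"

definition box_vertices :: "nat \<Rightarrow> (nat \<Rightarrow> real) \<Rightarrow> (nat \<Rightarrow> real) \<Rightarrow> (nat \<Rightarrow> real) set" where
  "box_vertices K lo hi = (\<Pi>\<^sub>E k\<in>{1..K}. {lo k, hi k})"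

definition param_interval_mat ::
  "nat \<Rightarrow> nat \<Rightarrow> (nat \<Rightarrow> real mat) \<Rightarrow> (nat \<Rightarrow> real) set \<Rightarrow> real mat set" where
  "param_interval_mat n K A P = param_mat n K A ` P"

definition family_schur_stable :: "real mat set \<Rightarrow> bool" where
  "family_schur_stable F \<longleftrightarrow> (\<forall>M\<in>F. schur_stable M)"

definition family_symmetric :: "real mat set \<Rightarrow> bool" where
  "family_symmetric F \<longleftrightarrow> (\<forall>M\<in>F. symmetric_matrix M)"

end

theory Submission
  imports Defs "Jordan_Normal_Form.Spectral_Radius" "HOL-Analysis.L2_Norm"
begin

text \<open>
  The set of Schur stable matrices is not convex, so stability at the vertices of a box need
  not pass to its interior. For symmetric matrices it does, because there Schur stability is
  a convex condition: a symmetric matrix is Schur stable if and only if it strictly shrinks the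
  Euclidean norm of every nonzero complex vector (\<open>schur_stable_iff_contractive\<close>). For fixed
  \<open>x\<close> the norm of \<open>A(p) x\<close> is a convex function of \<open>p\<close>, hence a strict bound by the norm of
  \<open>x\<close> at both ends of a segment holds on the whole segment (\<open>contractive_convex\<close>). Moving
  one coordinate at a time carries the bound from the vertices to every point of the
  box (\<open>box_induct\<close>).

  Contractive matrices are stable by evaluation on an eigenvector. The converse replaces
  the spectral theorem by a growth argument. Self-adjointness and the Cauchy-Schwarz
  inequality give \<open>\<parallel>Gx\<parallel>\<^sup>2 = \<langle>x, G G x\<rangle> \<le> \<parallel>x\<parallel> \<parallel>G G x\<parallel>\<close>, so the ratios
  \<open>\<parallel>G^(k+1) x\<parallel> / \<parallel>G^k x\<parallel>\<close> never decrease: a nonzero vector that \<open>G\<close> stretches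
  by a factor \<open>t > 1\<close> has an orbit growing at least like \<open>t^k\<close> (\<open>hermitian_power_growth\<close>). The powers of a
  matrix of spectral radius below 1 are bounded, by the Jordan normal form. If a Hermitian \<open>H\<close>
  is stable but does not shrink \<open>x\<close>, then for \<open>t > 1\<close> close enough to 1 the matrix \<open>t H\<close>
  is still stable and stretches \<open>x\<close> by at least the factor \<open>t\<close>, a contradiction.
\<close>

section \<open>The Euclidean norm of complex vectors\<close>

definition l2norm_vec :: "complex vec \<Rightarrow> real" where
  "l2norm_vec v = L2_set (\<lambda>i. cmod (v $ i)) {..<dim_vec v}"

lemma l2norm_vec_nonneg: "0 \<le> l2norm_vec v"
  by (simp add: l2norm_vec_def)

lemma l2norm_vec_pos:
  assumes "v \<in> carrier_vec n" "v \<noteq> 0\<^sub>v n"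
  shows "0 < l2norm_vec v"
proof -
  from assms have "\<exists>i<n. v $ i \<noteq> 0"
    by (metis carrier_vecD eq_vecI index_zero_vec(1) index_zero_vec(2))
  hence "l2norm_vec v \<noteq> 0"
    using assms(1) by (auto simp: l2norm_vec_def L2_set_eq_0_iff)
  thus ?thesis using l2norm_vec_nonneg[of v] by linarith
qed

lemma l2norm_vec_smult: "l2norm_vec (c \<cdot>\<^sub>v v) = cmod c * l2norm_vec v"
proof -
  have "l2norm_vec (c \<cdot>\<^sub>v v) = L2_set (\<lambda>i. cmod c * cmod (v $ i)) {..<dim_vec v}"
    unfolding l2norm_vec_def by (auto intro!: L2_set_cong simp: norm_mult)
  thus ?thesis by (simp add: l2norm_vec_def L2_set_right_distrib)
qed

lemma l2norm_vec_triangle: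
  assumes "u \<in> carrier_vec n" "v \<in> carrier_vec n"
  shows "l2norm_vec (u + v) \<le> l2norm_vec u + l2norm_vec v"
proof -
  have "l2norm_vec (u + v) \<le> L2_set (\<lambda>i. cmod (u $ i) + cmod (v $ i)) {..<n}"
    using assms unfolding l2norm_vec_def
    by (auto intro!: L2_set_mono simp: norm_triangle_ineq)
  also have "\<dots> \<le> l2norm_vec u + l2norm_vec v"
    using assms unfolding l2norm_vec_def by (auto intro: L2_set_triangle_ineq)
  finally show ?thesis .
qed

text \<open>The right-hand side depends on \<open>B\<close> only through \<open>c\<close>, so it bounds the whole orbit
  of \<open>x\<close> under a power-bounded matrix.\<close>
lemma l2norm_mult_mat_vec_le:
  assumes B: "B \<in> carrier_mat n n" and x: "x \<in> carrier_vec n" and nb: "norm_bound B c"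
  shows "l2norm_vec (B *\<^sub>v x) \<le> (\<Sum>i<n. \<Sum>j<n. c * cmod (x $ j))"
proof -
  have "cmod ((B *\<^sub>v x) $ i) \<le> (\<Sum>j<n. c * cmod (x $ j))" if i: "i < n" for i
  proof -
    have "cmod ((B *\<^sub>v x) $ i) = cmod (\<Sum>j<n. B $$ (i,j) * x $ j)"
      using B x i by (simp add: scalar_prod_def atLeast0LessThan)
    also have "\<dots> \<le> (\<Sum>j<n. cmod (B $$ (i,j) * x $ j))"
      by (rule norm_sum)
    also have "\<dots> \<le> (\<Sum>j<n. c * cmod (x $ j))"
      using nb B i by (intro sum_mono) (auto simp: norm_mult norm_bound_def intro!: mult_right_mono)
    finally show ?thesis .
  qed
  moreover have "l2norm_vec (B *\<^sub>v x) \<le> (\<Sum>i<n. cmod ((B *\<^sub>v x) $ i))"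
    using B L2_set_le_sum[of "{..<n}" "\<lambda>i. cmod ((B *\<^sub>v x) $ i)"]
    by (simp add: l2norm_vec_def del: index_mult_mat_vec)
  ultimately show ?thesis by (meson order_trans sum_mono lessThan_iff)
qed

section \<open>Growth of orbits under Hermitian matrices\<close>

definition hermitian :: "complex mat \<Rightarrow> bool" where
  "hermitian H \<longleftrightarrow> (\<forall>i<dim_row H. \<forall>j<dim_col H. H $$ (j,i) = cnj (H $$ (i,j)))"

text \<open>Shifting one factor \<open>G\<close> across the inner product turns \<open>\<langle>Gx, Gx\<rangle>\<close> into
  \<open>\<langle>x, G G x\<rangle>\<close>, to which the Cauchy-Schwarz inequality applies.\<close>
lemma hermitian_norm_square_le:
  assumes G: "G \<in> carrier_mat n n" and h: "hermitian G" and x: "x \<in> carrier_vec n"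
  shows "(l2norm_vec (G *\<^sub>v x))\<^sup>2 \<le> l2norm_vec x * l2norm_vec (G *\<^sub>v (G *\<^sub>v x))"
proof -
  define y where "y = G *\<^sub>v x"
  define z where "z = G *\<^sub>v y"
  have yc: "y \<in> carrier_vec n" and zc: "z \<in> carrier_vec n"
    using G x by (auto simp: y_def z_def)
  have y: "y $ i = (\<Sum>j<n. G $$ (i,j) * x $ j)" if "i < n" for i
    using G x that by (simp add: y_def scalar_prod_def atLeast0LessThan)
  have z: "z $ j = (\<Sum>i<n. G $$ (j,i) * y $ i)" if "j < n" for j
    using G yc that by (simp add: z_def scalar_prod_def atLeast0LessThan)
  have "complex_of_real ((l2norm_vec y)\<^sup>2) = (\<Sum>i<n. y $ i * cnj (y $ i))"
    using yc by (simp add: l2norm_vec_def L2_set_def sum_nonneg flip: complex_norm_square)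
  also have "\<dots> = (\<Sum>i<n. \<Sum>j<n. G $$ (i,j) * x $ j * cnj (y $ i))"
    by (rule sum.cong) (auto simp: y sum_distrib_right)
  also have "\<dots> = (\<Sum>j<n. \<Sum>i<n. G $$ (i,j) * x $ j * cnj (y $ i))"
    by (rule sum.swap)
  also have "\<dots> = (\<Sum>j<n. x $ j * cnj (z $ j))"
  proof (rule sum.cong[OF refl])
    fix j assume j: "j \<in> {..<n}"
    have "G $$ (i,j) = cnj (G $$ (j,i))" if "i < n" for i
      using h[unfolded hermitian_def, rule_format, of j i] G j that by simp
    thus "(\<Sum>i<n. G $$ (i,j) * x $ j * cnj (y $ i)) = x $ j * cnj (z $ j)"
      using j by (auto simp: z sum_distrib_left intro!: sum.cong)
  qed
  finally have eq: "complex_of_real ((l2norm_vec y)\<^sup>2) = (\<Sum>j<n. x $ j * cnj (z $ j))" .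
  have "(l2norm_vec y)\<^sup>2 = cmod (\<Sum>j<n. x $ j * cnj (z $ j))"
    by (metis eq abs_of_nonneg norm_of_real zero_le_power2)
  also have "\<dots> \<le> (\<Sum>j<n. \<bar>cmod (x $ j)\<bar> * \<bar>cmod (z $ j)\<bar>)"
    by (rule order_trans[OF norm_sum]) (simp add: norm_mult)
  also have "\<dots> \<le> l2norm_vec x * l2norm_vec z"
    using x zc L2_set_mult_ineq[of "\<lambda>j. cmod (x $ j)" "\<lambda>j. cmod (z $ j)" "{..<n}"]
    by (simp add: l2norm_vec_def)
  finally show ?thesis by (simp add: y_def z_def)
qed

text \<open>By the previous inequality the stretching factor of \<open>G\<close> at \<open>Gy\<close> is at least
  its stretching factor at \<open>y\<close>, so the initial factor \<open>t\<close> persists along the orbit.\<close>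
lemma hermitian_power_growth:
  assumes G: "G \<in> carrier_mat n n" and h: "hermitian G" and x: "x \<in> carrier_vec n"
    and t: "0 \<le> t" and stretch: "t * l2norm_vec x \<le> l2norm_vec (G *\<^sub>v x)"
  shows "t ^ k * l2norm_vec x \<le> l2norm_vec ((G ^\<^sub>m k) *\<^sub>v x)"
  using x stretch
proof (induction k arbitrary: x)
  case 0
  thus ?case using G by simp
next
  case (Suc k)
  let ?y = "G *\<^sub>v x"
  have y: "?y \<in> carrier_vec n" using G Suc.prems by simp
  have "t * l2norm_vec ?y \<le> l2norm_vec (G *\<^sub>v ?y)"
  proof (cases "x = 0\<^sub>v n")
    case True
    hence "?y = 0\<^sub>v n" using G by (intro eq_vecI) auto
    moreover have "l2norm_vec (0\<^sub>v n) = 0" by (simp add: l2norm_vec_def L2_set_eq_0_iff)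
    ultimately show ?thesis using l2norm_vec_nonneg by simp
  next
    case False
    hence pos: "0 < l2norm_vec x" using Suc.prems l2norm_vec_pos by blast
    have "l2norm_vec x * (t * l2norm_vec ?y) \<le> (l2norm_vec ?y)\<^sup>2"
      using mult_right_mono[OF Suc.prems(2) l2norm_vec_nonneg[of ?y]]
      by (simp add: power2_eq_square ac_simps)
    also have "\<dots> \<le> l2norm_vec x * l2norm_vec (G *\<^sub>v ?y)"
      by (rule hermitian_norm_square_le[OF G h Suc.prems(1)])
    finally show ?thesis using pos by simp
  qed
  hence "t ^ k * l2norm_vec ?y \<le> l2norm_vec ((G ^\<^sub>m k) *\<^sub>v ?y)"
    by (rule Suc.IH[OF y])
  moreover have "t ^ Suc k * l2norm_vec x \<le> t ^ k * l2norm_vec ?y"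
    using mult_left_mono[OF Suc.prems(2), of "t ^ k"] t by (simp add: ac_simps)
  moreover have "(G ^\<^sub>m Suc k) *\<^sub>v x = (G ^\<^sub>m k) *\<^sub>v ?y"
    using G Suc.prems by (simp add: assoc_mult_mat_vec[of _ n n _ n])
  ultimately show ?case by simp
qed

section \<open>Schur stability as contractivity\<close>

definition contractive :: "complex mat \<Rightarrow> bool" where
  "contractive H \<longleftrightarrow>
     (\<forall>x\<in>carrier_vec (dim_col H). x \<noteq> 0\<^sub>v (dim_col H) \<longrightarrow> l2norm_vec (H *\<^sub>v x) < l2norm_vec x)"

lemma eigenvalue_norm_less_1_if_contractive:
  assumes H: "H \<in> carrier_mat n n" and c: "contractive H" and e: "eigenvalue H \<mu>"
  shows "cmod \<mu> < 1"
proof -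
  obtain v where v: "v \<in> carrier_vec n" "v \<noteq> 0\<^sub>v n" "H *\<^sub>v v = \<mu> \<cdot>\<^sub>v v"
    using e H unfolding eigenvalue_def eigenvector_def by auto
  hence "cmod \<mu> * l2norm_vec v < l2norm_vec v"
    using c H unfolding contractive_def by (auto simp flip: l2norm_vec_smult)
  thus ?thesis using l2norm_vec_pos[OF v(1,2)] by simp
qed

lemma smult_mat_mult_vec:
  fixes H :: "'a :: comm_ring_1 mat"
  assumes "H \<in> carrier_mat n m" "x \<in> carrier_vec m"
  shows "(c \<cdot>\<^sub>m H) *\<^sub>v x = c \<cdot>\<^sub>v (H *\<^sub>v x)"
  using assms by (intro eq_vecI) auto

lemma eigenvalue_smult:
  fixes H :: "complex mat"
  assumes H: "H \<in> carrier_mat n n" and t: "t \<noteq> 0" and e: "eigenvalue (t \<cdot>\<^sub>m H) \<mu>"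
  shows "eigenvalue H (\<mu> / t)"
proof -
  obtain v where v: "v \<in> carrier_vec n" "v \<noteq> 0\<^sub>v n" "(t \<cdot>\<^sub>m H) *\<^sub>v v = \<mu> \<cdot>\<^sub>v v"
    using e H unfolding eigenvalue_def eigenvector_def by auto
  have "t \<cdot>\<^sub>v (H *\<^sub>v v) = \<mu> \<cdot>\<^sub>v v"
    using v H by (simp add: smult_mat_mult_vec[of H n n])
  hence "(1 / t) \<cdot>\<^sub>v (t \<cdot>\<^sub>v (H *\<^sub>v v)) = (1 / t) \<cdot>\<^sub>v (\<mu> \<cdot>\<^sub>v v)" by simp
  hence "H *\<^sub>v v = (\<mu> / t) \<cdot>\<^sub>v v" using t by (simp add: smult_smult_assoc)
  thus ?thesis using v H unfolding eigenvalue_def eigenvector_def by auto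
qed

text \<open>The strict bound on the finite spectrum leaves room to scale \<open>H\<close> by some \<open>t > 1\<close>
  without leaving the power-bounded regime; the geometric growth of the orbit of a vector
  that \<open>H\<close> does not shrink then contradicts power-boundedness.\<close>
lemma contractive_if_hermitian_eigenvalues_norm_less_1:
  assumes H: "H \<in> carrier_mat n n" and h: "hermitian H"
    and ev: "\<And>\<mu>. eigenvalue H \<mu> \<Longrightarrow> cmod \<mu> < 1"
  shows "contractive H"
proof (rule ccontr)
  assume "\<not> contractive H"
  then obtain x where x: "x \<in> carrier_vec n" "x \<noteq> 0\<^sub>v n"
    and nshrink: "l2norm_vec x \<le> l2norm_vec (H *\<^sub>v x)"
    using H unfolding contractive_def by force
  have n: "n > 0" using x by (cases n) auto
  define r where "r = spectral_radius H"
  have r: "0 \<le> r" "r < 1"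
    using spectral_radius_mem_max(1)[OF H n] ev by (auto simp: r_def spectrum_def)
  \<comment> \<open>Any \<open>t\<close> strictly between 1 and \<open>1 / r\<close> would do; this one also covers \<open>r = 0\<close>.\<close>
  define t where "t = 2 / (1 + r)"
  have t: "1 < t" "t * r < 1" using r by (auto simp: t_def field_simps)
  let ?G = "complex_of_real t \<cdot>\<^sub>m H"
  have G: "?G \<in> carrier_mat n n" using H by simp
  have hG: "hermitian ?G"
    unfolding hermitian_def
  proof (intro allI impI)
    fix i j assume "i < dim_row ?G" "j < dim_col ?G"
    moreover from this have "H $$ (j,i) = cnj (H $$ (i,j))"
      using h[unfolded hermitian_def, rule_format, of i j] by simp
    ultimately show "?G $$ (j,i) = cnj (?G $$ (i,j))"
      using H by simp
  qed
  have "spectral_radius ?G < 1"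
  proof -
    obtain \<mu> where \<mu>: "eigenvalue ?G \<mu>" "spectral_radius ?G = cmod \<mu>"
      using spectral_radius_mem_max(1)[OF G n] by (auto simp: spectrum_def)
    have "eigenvalue H (\<mu> / t)" using eigenvalue_smult[OF H _ \<mu>(1)] t by simp
    hence "cmod (\<mu> / t) \<le> r"
      unfolding r_def by (intro spectral_radius_mem_max(2)[OF H n]) (auto simp: spectrum_def)
    hence "cmod \<mu> \<le> t * r" using t by (simp add: norm_divide field_simps)
    thus ?thesis using \<mu> t by simp
  qed
  then obtain c where c: "\<And>k. norm_bound (?G ^\<^sub>m k) c"
    using spectral_radius_jnf_norm_bound_less_1_upper_triangular[OF G] by blast
  define C where "C = (\<Sum>i<n. \<Sum>j<n. c * cmod (x $ j))"
  have "?G *\<^sub>v x = complex_of_real t \<cdot>\<^sub>v (H *\<^sub>v x)"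
    using H x by (simp add: smult_mat_mult_vec[of H n n])
  hence "t * l2norm_vec x \<le> l2norm_vec (?G *\<^sub>v x)"
    using nshrink t by (simp add: l2norm_vec_smult)
  hence "t ^ k * l2norm_vec x \<le> C" for k
    using hermitian_power_growth[OF G hG x(1), of t k] t G
      l2norm_mult_mat_vec_le[OF pow_carrier_mat[OF G] x(1) c, of k]
    unfolding C_def by linarith
  moreover obtain k where "C / l2norm_vec x < t ^ k"
    using real_arch_pow[OF t(1)] by blast
  ultimately show False using l2norm_vec_pos[OF x] by (simp add: field_simps not_le[symmetric])
qed

text \<open>The bridge from eigenvalues to a condition that is convex in the matrix.\<close>
lemma schur_stable_iff_contractive:
  assumes M: "M \<in> carrier_mat n n" and sym: "symmetric_matrix M"
  shows "schur_stable M \<longleftrightarrow> contractive (map_mat complex_of_real M)"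
proof -
  have "M $$ (j,i) = M $$ (i,j)" if "i < n" "j < n" for i j
    using sym M that unfolding symmetric_matrix_def
    by (metis carrier_matD index_transpose_mat(1))
  hence "hermitian (map_mat complex_of_real M)"
    using M by (auto simp: hermitian_def)
  thus ?thesis
    unfolding schur_stable_def
    using M eigenvalue_norm_less_1_if_contractive[of "map_mat complex_of_real M" n]
      contractive_if_hermitian_eigenvalues_norm_less_1[of "map_mat complex_of_real M" n]
    by auto
qed

lemma contractive_convex:
  assumes A: "A \<in> carrier_mat n n" "contractive A" and B: "B \<in> carrier_mat n n" "contractive B"
    and t: "0 \<le> t" "t \<le> 1"
  shows "contractive (complex_of_real (1 - t) \<cdot>\<^sub>m A + complex_of_real t \<cdot>\<^sub>m B)" (is "contractive ?C")
  unfolding contractive_def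
proof (intro ballI impI)
  fix x :: "complex vec"
  assume "x \<in> carrier_vec (dim_col ?C)" "x \<noteq> 0\<^sub>v (dim_col ?C)"
  hence x: "x \<in> carrier_vec n" "x \<noteq> 0\<^sub>v n" using B by auto
  let ?a = "l2norm_vec (A *\<^sub>v x)" and ?b = "l2norm_vec (B *\<^sub>v x)"
  have ab: "?a < l2norm_vec x" "?b < l2norm_vec x"
    using A B x by (auto simp: contractive_def)
  have "?C *\<^sub>v x = (complex_of_real (1 - t) \<cdot>\<^sub>m A) *\<^sub>v x + (complex_of_real t \<cdot>\<^sub>m B) *\<^sub>v x"
    using A B x by (intro add_mult_distrib_mat_vec[of _ n n]) auto
  also have "\<dots> = complex_of_real (1 - t) \<cdot>\<^sub>v (A *\<^sub>v x) + complex_of_real t \<cdot>\<^sub>v (B *\<^sub>v x)"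
    using A B x by (simp add: smult_mat_mult_vec[of _ n n])
  finally have "l2norm_vec (?C *\<^sub>v x)
      \<le> l2norm_vec (complex_of_real (1 - t) \<cdot>\<^sub>v (A *\<^sub>v x)) + l2norm_vec (complex_of_real t \<cdot>\<^sub>v (B *\<^sub>v x))"
    using A B x by (simp add: l2norm_vec_triangle[of _ n])
  also have "\<dots> = (1 - t) * ?a + t * ?b"
    unfolding l2norm_vec_smult norm_of_real using t by simp
  also have "\<dots> < l2norm_vec x"
    using convex_bound_lt[OF ab, of "1 - t" t] t by simp
  finally show "l2norm_vec (?C *\<^sub>v x) < l2norm_vec x" .
qed

section \<open>From the vertices to the box\<close>

text \<open>The coordinates are released from \<open>{lo k, hi k}\<close> to \<open>{lo k..hi k}\<close> one after the
  other, so only segments parallel to an axis are needed.\<close>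
lemma box_induct:
  fixes lo hi :: "nat \<Rightarrow> real"
  assumes vertex: "\<And>p. p \<in> box_vertices K lo hi \<Longrightarrow> P p"
    and segment: "\<And>p k c. k \<in> {1..K} \<Longrightarrow> lo k \<le> c \<Longrightarrow> c \<le> hi k
      \<Longrightarrow> P (p(k := lo k)) \<Longrightarrow> P (p(k := hi k)) \<Longrightarrow> P (p(k := c))"
    and p: "p \<in> param_box K lo hi"
  shows "P p"
proof -
  let ?mixed = "\<lambda>J. \<Pi>\<^sub>E k\<in>{1..K}. if k \<in> J then {lo k..hi k} else {lo k, hi k}"
  have "\<forall>p\<in>?mixed J. P p" if "finite J" "J \<subseteq> {1..K}" for J
    using that
  proof (induction J rule: finite_induct)
    case empty
    thus ?case using vertex by (simp add: box_vertices_def)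
  next
    case (insert k J)
    show ?case
    proof
      fix p assume p: "p \<in> ?mixed (insert k J)"
      have k: "k \<in> {1..K}" using insert.prems by simp
      have "p(k := c) \<in> ?mixed J" if "c \<in> {lo k, hi k}" for c
        using p k insert.hyps(2) that by (auto simp: PiE_iff extensional_def split: if_splits)
      hence "P (p(k := lo k))" "P (p(k := hi k))" using insert by auto
      moreover have "p k \<in> {lo k..hi k}" using PiE_mem[OF p k] by simp
      ultimately have "P (p(k := p k))" using segment[OF k, of "p k" p] by simp
      thus "P p" by simp
    qed
  qed
  from this[of "{1..K}"] p show ?thesis
    by (auto simp: param_box_def PiE_iff)
qed

lemma param_mat_segment:
  "map_mat complex_of_real (param_mat n K A (p(k := (1 - t) * a + t * b))) =
     complex_of_real (1 - t) \<cdot>\<^sub>m map_mat complex_of_real (param_mat n K A (p(k := a))) +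
     complex_of_real t \<cdot>\<^sub>m map_mat complex_of_real (param_mat n K A (p(k := b)))"
    (is "_ = complex_of_real (1 - t) \<cdot>\<^sub>m map_mat _ ?Ma + complex_of_real t \<cdot>\<^sub>m map_mat _ ?Mb")
proof -
  have coord: "(p(k := (1 - t) * a + t * b)) j = (1 - t) * (p(k := a)) j + t * (p(k := b)) j" for j
    by (simp add: algebra_simps)
  have "param_mat n K A (p(k := (1 - t) * a + t * b)) $$ (i,j)
      = (1 - t) * ?Ma $$ (i,j) + t * ?Mb $$ (i,j)" if "i < n" "j < n" for i j
    using that unfolding param_mat_def coord
    by (simp add: algebra_simps sum.distrib sum_subtractf sum_distrib_left del: fun_upd_apply)
  thus ?thesis
    by (intro eq_matI) (auto simp: param_mat_def simp flip: of_real_add of_real_mult of_real_diff)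
qed

theorem theorem5p1:
  fixes n K :: nat
    and A :: "nat \<Rightarrow> real mat"
    and lo hi :: "nat \<Rightarrow> real"
  assumes "\<And>k. k \<in> {1..K} \<Longrightarrow> lo k \<le> hi k"
    and "\<And>k. k \<in> {0..K} \<Longrightarrow> A k \<in> carrier_mat n n"
    and "family_symmetric (param_interval_mat n K A (param_box K lo hi))"
  shows "family_schur_stable (param_interval_mat n K A (param_box K lo hi)) \<longleftrightarrow>
         (\<forall>p\<in>box_vertices K lo hi. schur_stable (param_mat n K A p))"
proof -
  let ?C = "\<lambda>p. contractive (map_mat complex_of_real (param_mat n K A p))"
  have carrier: "param_mat n K A p \<in> carrier_mat n n" for p
    by (simp add: param_mat_def)
  have stable_iff: "schur_stable (param_mat n K A p) \<longleftrightarrow> ?C p" if "p \<in> param_box K lo hi" for p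
    using assms(3) that
    by (intro schur_stable_iff_contractive[OF carrier])
       (auto simp: family_symmetric_def param_interval_mat_def)
  have vertices: "box_vertices K lo hi \<subseteq> param_box K lo hi"
    unfolding box_vertices_def param_box_def using assms(1) by (intro PiE_mono) auto
  have segment: "?C (p(k := c))"
    if "lo k \<le> c" "c \<le> hi k" and C: "?C (p(k := lo k))" "?C (p(k := hi k))" for p k c
  proof -
    obtain t where t: "0 \<le> t" "t \<le> 1" and c: "c = (1 - t) * lo k + t * hi k"
    proof (cases "lo k = hi k")
      case True
      with \<open>lo k \<le> c\<close> \<open>c \<le> hi k\<close> show ?thesis by (intro that[of 0]) auto
    next
      case False
      define t where "t = (c - lo k) / (hi k - lo k)"
      have "t * (hi k - lo k) = c - lo k" using False by (simp add: t_def)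
      hence "c = (1 - t) * lo k + t * hi k" by (simp add: algebra_simps)
      moreover have "0 \<le> t" "t \<le> 1"
        using False \<open>lo k \<le> c\<close> \<open>c \<le> hi k\<close> by (auto simp: t_def divide_simps)
      ultimately show ?thesis by (intro that)
    qed
    show ?thesis
      unfolding c param_mat_segment
      using C carrier t by (intro contractive_convex[of _ n]) auto
  qed
  have "(\<forall>p\<in>param_box K lo hi. ?C p) \<longleftrightarrow> (\<forall>p\<in>box_vertices K lo hi. ?C p)"
    using vertices box_induct[of K lo hi ?C] segment by blast
  thus ?thesis
    using stable_iff vertices
    by (auto simp: family_schur_stable_def param_interval_mat_def)
qed

end
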